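(* Let $q$ be a prime power and let $n,k$ be integers with $2\leq k\leq n/2$. Let $G_q(n,k)$ be the Grassmann graph. Then the metric dimension of $G_q(n,k)$ is at most ${n \brack 1}_q=\frac{q^n-1}{q-1}$.
   Context: $V(n,q)$ denotes the $n$-dimensional vector space over the finite field $\mathbb{F}_q$. The Grassmann graph $G_q(n,k)$ has as its vertex set the set of all $k$-dimensional subspaces of $V(n,q)$; two vertices are adjacent if the corresponding subspaces intersect in a subspace of dimension $k-1$. (The graph distance between vertices $X$ and $Y$ is $k-\dim(X\cap Y)$.) A resolving set for a graph $\Gamma=(V,E)$ is a set of vertices $S=\{v_1,\ldots,v_m\}$ such that for all $u,w\in V$, the lists of graph distances $(d(u,v_1),\ldots,d(u,v_m))$ and $(d(w,v_1),\ldots,d(w,v_m))$ are equal if and only if $u=w$. The metric dimension $\mu(\Gamma)$ of $\Gamma$ is the smallest size of a resolving set for $\Gamma$. The Gaussian binomial coefficient is ${n \brack k}_q = \prod_{i=0}^{k-1} \frac{q^n-q^i}{q^k-q^i}$; in particular ${n \brack 1}_q=\frac{q^n-1}{q-1}$ is the number of $1$-dimensional subspaces of $V(n,q)$. *)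

theory Defs
  imports "HOL-Analysis.Cartesian_Space" "Graph_Theory.Pair_Digraph" "Graph_Theory.Shortest_Path"
begin

text \<open>Hop distance: least cost of a walk when every arc has weight 1
  (infinite if there is no walk).\<close>

definition graph_dist :: "('a, 'b) pre_digraph \<Rightarrow> 'a \<Rightarrow> 'a \<Rightarrow> ereal" where
  "graph_dist G u v = wf_digraph.\<mu> G (\<lambda>_. 1) u v"

definition resolving_set :: "('a, 'b) pre_digraph \<Rightarrow> 'a set \<Rightarrow> bool" where
  "resolving_set G S \<longleftrightarrow> finite S \<and> S \<subseteq> verts G \<and>
     (\<forall>u\<in>verts G. \<forall>w\<in>verts G. (\<forall>v\<in>S. graph_dist G u v = graph_dist G w v) \<longleftrightarrow> u = w)"

definition metric_dimension :: "('a, 'b) pre_digraph \<Rightarrow> nat" where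
  "metric_dimension G = (LEAST m. \<exists>S. resolving_set G S \<and> card S = m)"

text \<open>The ambient space \<open>V(n,q)\<close> is \<open>'f ^ 'n\<close>, where \<open>'f\<close> is a field with \<open>q\<close> elements and
  \<open>CARD('n) = n\<close>. Each edge is represented by the two opposite arcs; the intersection
  condition is written with \<open>Suc\<close> to avoid truncated subtraction.\<close>

definition grassmann_graph :: "nat \<Rightarrow> ('f::field ^ 'n) set pair_pre_digraph" where
  "grassmann_graph k =
     (let vertices = {U. vec.subspace U \<and> vec.dim U = k}
      in \<lparr> pverts = vertices,
           parcs = {(U, W). U \<in> vertices \<and> W \<in> vertices \<and> Suc (vec.dim (U \<inter> W)) = k} \<rparr>)"

definition gaussian_binomial :: "nat \<Rightarrow> nat \<Rightarrow> nat \<Rightarrow> real" where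
  "gaussian_binomial q n k = (\<Prod>i<k. (real q ^ n - real q ^ i) / (real q ^ k - real q ^ i))"

lemma pair_graph_grassmann_graph:
  "pair_graph (grassmann_graph k :: ('f::{field,finite} ^ 'n) set pair_pre_digraph)"
proof
  show "symmetric (with_proj (grassmann_graph k :: ('f ^ 'n) set pair_pre_digraph))"
    unfolding symmetric_def
    by (rule symI) (simp add: grassmann_graph_def Int_commute)
qed (use finite in \<open>simp_all add: grassmann_graph_def split: prod.splits\<close>, auto)

text \<open>Hence the locale constant used in \<^const>\<open>graph_dist\<close> is applied inside its domain.\<close>

lemma wf_digraph_grassmann_graph:
  "wf_digraph (with_proj (grassmann_graph k :: ('f::field ^ 'n) set pair_pre_digraph))"
  by unfold_locales (auto simp: grassmann_graph_def Let_def)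

lemma graph_dist_grassmann_graph:
  fixes u v :: "('f::field ^ 'n) set" and k :: nat
  defines "G \<equiv> with_proj (grassmann_graph k)"
  shows "graph_dist G u v = (INF p\<in>{p. pre_digraph.awalk G u p v}. ereal (real (length p)))"
proof -
  interpret wf_digraph G
    unfolding G_def by (rule wf_digraph_grassmann_graph)
  have "awalk_cost (\<lambda>_. 1) p = real (length p)" for p
    by (induction p) auto
  then show ?thesis
    by (simp add: graph_dist_def \<mu>_def)
qed

end

theory Submission
  imports Defs
begin

text \<open>
  Distances in the Grassmann graph are \<open>k - dim (U \<inter> S)\<close>, so the distance from \<open>U\<close> to \<open>S\<close>
  determines the size of \<open>U \<inter> S\<close>, which is, up to the zero vector, the inner product of the
  indicator vectors \<open>\<chi>\<^sub>U\<close> and \<open>\<chi>\<^sub>S\<close> of the nonzero points of \<open>U\<close> and \<open>S\<close>.  Choose vertices whose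
  indicator vectors form a basis of the real span of all vertex indicators.  If \<open>U\<close> and \<open>W\<close> have
  the same distances to the chosen vertices, then \<open>\<chi>\<^sub>U - \<chi>\<^sub>W\<close> is orthogonal to that span; it also
  lies in the span, so it vanishes and \<open>U = W\<close>.  Thus the metric dimension is at most the
  dimension of the span.

  Every indicator \<open>\<chi>\<^sub>U\<close> is the sum of the indicators of the one-dimensional subspaces inside \<open>U\<close>.
  So the dimension of the span is at most the number of one-dimensional subspaces, which is
  \<open>(q\<^sup>n - 1) / (q - 1)\<close>.
\<close>

section \<open>Distances in the Grassmann graph\<close>

lemma grassmann_verts:
  "U \<in> pverts (grassmann_graph k) \<longleftrightarrow> vec.subspace U \<and> vec.dim U = k"
  by (simp add: grassmann_graph_def Let_def)

lemma grassmann_arcs: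
  "(U, W) \<in> parcs (grassmann_graph k) \<longleftrightarrow>
     U \<in> pverts (grassmann_graph k) \<and> W \<in> pverts (grassmann_graph k) \<and>
     Suc (vec.dim (U \<inter> W)) = k"
  by (simp add: grassmann_graph_def Let_def)

text \<open>Passing from \<open>U\<close> to a neighbour \<open>U'\<close> gains at most one dimension of intersection with \<open>S\<close>:
  within the \<open>k\<close>-dimensional space \<open>U'\<close>, the hyperplane \<open>U \<inter> U'\<close> cuts \<open>U' \<inter> S\<close> in at most one
  dimension less.\<close>

lemma dim_Int_neighbour_le:
  fixes U U' S :: "('f::field ^ 'n) set"
  assumes "vec.subspace U" "vec.subspace U'" "vec.subspace S"
    and "vec.dim U' = Suc (vec.dim (U \<inter> U'))"
  shows "vec.dim (U' \<inter> S) \<le> Suc (vec.dim (U \<inter> S))"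
proof -
  let ?A = "U \<inter> U'" and ?B = "U' \<inter> S"
  have sub: "vec.subspace ?A" "vec.subspace ?B"
    using assms vec.subspace_inter by blast+
  have "vec.dim {x + y |x y. x \<in> ?A \<and> y \<in> ?B} + vec.dim (?A \<inter> ?B) = vec.dim ?A + vec.dim ?B"
    using vec.dim_sums_Int[OF sub] by simp
  moreover have "vec.dim {x + y |x y. x \<in> ?A \<and> y \<in> ?B} \<le> vec.dim U'"
    by (rule vec.dim_subset) (use assms vec.subspace_add in blast)
  moreover have "vec.dim (?A \<inter> ?B) \<le> vec.dim (U \<inter> S)"
    by (rule vec.dim_subset) blast
  ultimately show ?thesis using assms by linarith
qed

text \<open>Conversely, some neighbour of \<open>U\<close> gains a dimension: keep a hyperplane of \<open>U\<close> that
  contains \<open>U \<inter> S\<close> and adjoin a vector of \<open>S\<close> outside \<open>U\<close>.\<close>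

lemma neighbour_closer:
  fixes U S :: "('f::field ^ 'n) set"
  assumes U: "U \<in> pverts (grassmann_graph k)" and S: "S \<in> pverts (grassmann_graph k)"
    and "U \<noteq> S"
  obtains U' where "(U, U') \<in> parcs (grassmann_graph k)"
    "Suc (vec.dim (U \<inter> S)) \<le> vec.dim (U' \<inter> S)"
proof -
  have sU: "vec.subspace U" "vec.dim U = k" and sS: "vec.subspace S" "vec.dim S = k"
    using U S by (simp_all add: grassmann_verts)
  have "\<not> S \<subseteq> U"
    using vec.subspace_dim_equal[OF sS(1) sU(1)] sU sS \<open>U \<noteq> S\<close> by auto
  then obtain s where s: "s \<in> S" "s \<notin> U" by blast
  obtain B where B: "B \<subseteq> U \<inter> S" "vec.independent B" "U \<inter> S \<subseteq> vec.span B"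
    using vec.maximal_independent_subset by blast
  obtain C where C: "B \<subseteq> C" "C \<subseteq> U" "vec.independent C" "U \<subseteq> vec.span C"
    using vec.maximal_independent_subset_extend[of B U] B by blast
  have "\<not> U \<subseteq> S"
    using vec.subspace_dim_equal[OF sU(1) sS(1)] sU sS \<open>U \<noteq> S\<close> by auto
  then have "C \<noteq> B"
    using B C vec.span_minimal[of B S] sS(1) by blast
  then obtain c where c: "c \<in> C" "c \<notin> B" using C(1) by blast
  have finC: "finite C" using C(3) vec.finiteI_independent by blast
  have cardC: "card C = k"
    using vec.basis_card_eq_dim[OF C(2,4,3)] sU by simp
  \<comment> \<open>The span of \<open>?D\<close> is the retained hyperplane; it contains \<open>U \<inter> S\<close> because \<open>c\<close> is not in \<open>B\<close>.\<close>
  let ?D = "C - {c}"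
  have D: "vec.independent ?D" "vec.span ?D \<subseteq> U" "vec.dim ?D = k - 1"
    using C(2,3) c finC cardC sU(1) vec.independent_mono[of C ?D] vec.span_minimal[of ?D U]
      vec.dim_eq_card_independent[of ?D] by auto
  have "0 < k" using cardC c finC by (metis card_gt_0_iff empty_iff)
  let ?U' = "vec.span (insert s ?D)"
  have dimU': "vec.dim ?U' = k"
    using D s \<open>0 < k\<close> by (auto simp: vec.dim_insert)
  have U': "?U' \<in> pverts (grassmann_graph k)"
    using dimU' by (simp only: grassmann_verts vec.subspace_span simp_thms)
  have "vec.span ?D \<subseteq> U \<inter> ?U'"
    using D(2) vec.span_mono[of ?D "insert s ?D"] by blast
  then have ge: "k - 1 \<le> vec.dim (U \<inter> ?U')"
    using vec.dim_subset D(3) vec.dim_span by metis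
  have "vec.dim (U \<inter> ?U') < k"
  proof (rule ccontr)
    assume "\<not> vec.dim (U \<inter> ?U') < k"
    then have "U \<inter> ?U' = ?U'"
      using vec.subspace_dim_equal[of "U \<inter> ?U'" ?U'] sU(1) dimU'
      by (simp add: vec.subspace_inter)
    then show False using s vec.span_base[of s "insert s ?D"] by blast
  qed
  then have arc: "(U, ?U') \<in> parcs (grassmann_graph k)"
    using U U' ge by (simp add: grassmann_arcs)
  have "U \<inter> S \<subseteq> vec.span ?D"
    using B(3) vec.span_mono[of B ?D] C(1) c by blast
  then have "insert s (U \<inter> S) \<subseteq> ?U' \<inter> S"
    using s vec.span_mono[of ?D "insert s ?D"] vec.span_base[of s "insert s ?D"] by blast
  then have "vec.dim (insert s (U \<inter> S)) \<le> vec.dim (?U' \<inter> S)"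
    by (rule vec.dim_subset)
  moreover have "s \<notin> vec.span (U \<inter> S)"
    using s sU(1) vec.span_minimal[of "U \<inter> S" U] by blast
  ultimately have "Suc (vec.dim (U \<inter> S)) \<le> vec.dim (?U' \<inter> S)"
    by (simp add: vec.dim_insert)
  with arc show thesis by (rule that)
qed

lemma grassmann_walk_length_ge:
  fixes U S :: "('f::field ^ 'n) set"
  assumes "pre_digraph.awalk (with_proj (grassmann_graph k)) U p S"
  shows "k \<le> vec.dim (U \<inter> S) + length p"
proof -
  interpret wf_digraph "with_proj (grassmann_graph k :: ('f ^ 'n) set pair_pre_digraph)"
    by (rule wf_digraph_grassmann_graph)
  show ?thesis
    using assms
  proof (induction p arbitrary: U)
    case Nil
    then show ?case by (auto simp: awalk_Nil_iff grassmann_verts)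
  next
    case (Cons e p)
    obtain U' where e: "e = (U, U')" and arc: "(U, U') \<in> parcs (grassmann_graph k)"
      and walk: "awalk U' p S"
      using Cons.prems by (cases e) (auto simp: awalk_Cons_iff)
    have "S \<in> pverts (grassmann_graph k)"
      using walk awalk_last_in_verts by fastforce
    then have "vec.dim (U' \<inter> S) \<le> Suc (vec.dim (U \<inter> S))"
      using arc dim_Int_neighbour_le[of U U' S] by (simp add: grassmann_arcs grassmann_verts)
    with Cons.IH[OF walk] show ?case by simp
  qed
qed

lemma ex_grassmann_walk:
  fixes U S :: "('f::field ^ 'n) set"
  assumes "U \<in> pverts (grassmann_graph k)" and S: "S \<in> pverts (grassmann_graph k)"
    and "k \<le> vec.dim (U \<inter> S) + m"
  shows "\<exists>p. pre_digraph.awalk (with_proj (grassmann_graph k)) U p S \<and> length p \<le> m"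
proof -
  interpret wf_digraph "with_proj (grassmann_graph k :: ('f ^ 'n) set pair_pre_digraph)"
    by (rule wf_digraph_grassmann_graph)
  show ?thesis
    using assms(1,3)
  proof (induction m arbitrary: U)
    case 0
    have "U = S"
    proof (rule ccontr)
      assume "U \<noteq> S"
      then obtain U' :: "('f ^ 'n) set" where "Suc (vec.dim (U \<inter> S)) \<le> vec.dim (U' \<inter> S)"
        using neighbour_closer[OF 0(1) S] by blast
      moreover have "vec.dim (U' \<inter> S) \<le> k"
        using vec.dim_subset[of "U' \<inter> S" S] S by (simp add: grassmann_verts)
      ultimately show False using 0 by simp
    qed
    then have "awalk U [] S" using S by (simp add: awalk_Nil_iff)
    then show ?case by (intro exI[of _ "[]"]) simp
  next
    case (Suc m)
    show ?case
    proof (cases "U = S")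
      case True
      then have "awalk U [] S" using S by (simp add: awalk_Nil_iff)
      then show ?thesis by (intro exI[of _ "[]"]) simp
    next
      case False
      obtain U' where arc: "(U, U') \<in> parcs (grassmann_graph k)"
        and "Suc (vec.dim (U \<inter> S)) \<le> vec.dim (U' \<inter> S)"
        using neighbour_closer[OF Suc.prems(1) S False] by blast
      then obtain p where "awalk U' p S" "length p \<le> m"
        using Suc.IH[of U'] Suc.prems by (auto simp: grassmann_arcs)
      then show ?thesis
        using arc by (intro exI[of _ "(U, U') # p"]) (simp add: awalk_Cons_iff)
    qed
  qed
qed

text \<open>A walk from \<open>U\<close> to \<open>S\<close> has to raise the intersection with \<open>S\<close> from \<open>dim (U \<inter> S)\<close> to \<open>k\<close>,
  and each step can raise it by one, but by no more.\<close>

lemma graph_dist_grassmann_eq: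
  fixes U S :: "('f::field ^ 'n) set"
  assumes "U \<in> pverts (grassmann_graph k)" and "S \<in> pverts (grassmann_graph k)"
  shows "graph_dist (with_proj (grassmann_graph k)) U S = ereal (real (k - vec.dim (U \<inter> S)))"
  unfolding graph_dist_grassmann_graph
proof (rule antisym)
  obtain p where "pre_digraph.awalk (with_proj (grassmann_graph k)) U p S"
    "length p \<le> k - vec.dim (U \<inter> S)"
    using ex_grassmann_walk[OF assms, of "k - vec.dim (U \<inter> S)"] by fastforce
  then show "(INF p\<in>{p. pre_digraph.awalk (with_proj (grassmann_graph k)) U p S}.
      ereal (real (length p))) \<le> ereal (real (k - vec.dim (U \<inter> S)))"
    by (intro INF_lower2[of p]) auto
  show "ereal (real (k - vec.dim (U \<inter> S)))
      \<le> (INF p\<in>{p. pre_digraph.awalk (with_proj (grassmann_graph k)) U p S}.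
          ereal (real (length p)))"
    by (rule INF_greatest) (use grassmann_walk_length_ge in fastforce)
qed

section \<open>Indicator vectors\<close>

text \<open>The zero vector is left out so that the indicator of a subspace is a sum of indicators of
  lines.\<close>

definition point_indicator :: "('f::{field,finite} ^ 'n) set \<Rightarrow> real ^ ('f ^ 'n)" where
  "point_indicator U = (\<chi> v. of_bool (v \<in> U \<and> v \<noteq> 0))"

lemma inner_point_indicator:
  "point_indicator U \<bullet> point_indicator W = real (card (U \<inter> W - {0}))"
proof -
  have "point_indicator U \<bullet> point_indicator W = (\<Sum>v\<in>UNIV. of_bool (v \<in> U \<inter> W - {0}))"
    unfolding inner_vec_def point_indicator_def by (rule sum.cong) auto
  also have "\<dots> = real (card (U \<inter> W - {0}))"
    by (simp only: sum_of_bool_eq Int_UNIV_left Collect_mem_eq finite)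
  finally show ?thesis .
qed

text \<open>This turns the dimensions read off from distances into the cardinalities that appear as
  inner products.\<close>

lemma card_subspace_cong_dim:
  fixes A B :: "('f::{field,finite} ^ 'n) set"
  assumes "vec.subspace A" "vec.subspace B" "vec.dim A = vec.dim B"
  shows "card A = card B"
  using vec.subspace_isomorphism[OF assms] card_image by metis

lemma point_indicator_inject:
  assumes "vec.subspace U" "vec.subspace W" "point_indicator U = point_indicator W"
  shows "U = W"
proof -
  have "v \<in> U \<longleftrightarrow> v \<in> W" for v
  proof (cases "v = 0")
    case True
    then show ?thesis using assms(1,2) vec.subspace_0 by blast
  next
    case False
    have "point_indicator U $ v = point_indicator W $ v" using assms(3) by simp
    with False show ?thesis by (simp add: point_indicator_def of_bool_def split: if_splits)
  qed
  then show ?thesis by blast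
qed

section \<open>Lines through the origin\<close>

abbreviation lines :: "('f::{field,finite} ^ 'n) set set" where
  "lines \<equiv> (\<lambda>v. vec.span {v}) ` (UNIV - {0})"

lemma mem_line_iff:
  fixes v :: "'f::{field,finite} ^ 'n"
  assumes "L \<in> lines" "v \<noteq> 0"
  shows "v \<in> L \<longleftrightarrow> L = vec.span {v}"
proof
  assume "v \<in> L"
  obtain w where w: "L = vec.span {w}" "w \<noteq> 0" using assms(1) by blast
  with \<open>v \<in> L\<close> obtain c where c: "v = c *s w" by (auto simp: vec.span_singleton)
  with assms(2) have "w = inverse c *s v" by auto
  then have "w \<in> vec.span {v}" by (auto simp: vec.span_singleton)
  then show "L = vec.span {v}"
    using w \<open>v \<in> L\<close>
    by (metis empty_subsetI insert_subset vec.span_minimal vec.subspace_span subset_antisym)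
qed (simp add: vec.span_base)

text \<open>The lines partition the nonzero vectors into classes of \<open>q - 1\<close> vectors.\<close>

lemma card_lines:
  "card (lines :: ('f::{field,finite} ^ 'n) set set) * (CARD('f) - 1) = CARD('f) ^ CARD('n) - 1"
proof -
  let ?V = "UNIV - {0} :: ('f ^ 'n) set"
  have fibre: "card {v \<in> ?V. vec.span {v} = L} = CARD('f) - 1" if L: "L \<in> lines" for L
  proof -
    obtain w where w: "L = vec.span {w}" "w \<noteq> 0" using L by blast
    have "{v \<in> ?V. vec.span {v} = L} = L - {0}"
      using mem_line_iff[OF L] by auto
    also have "\<dots> = (\<lambda>c. c *s w) ` (UNIV - {0})"
      using w by (auto simp: vec.span_singleton)
    finally have "{v \<in> ?V. vec.span {v} = L} = (\<lambda>c. c *s w) ` (UNIV - {0})" .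
    moreover have "inj_on (\<lambda>c. c *s w) (UNIV - {0})"
      using w(2) by (auto intro!: inj_onI)
    ultimately show ?thesis by (simp only: card_image card_Diff_singleton UNIV_I)
  qed
  have "CARD('f) ^ CARD('n) - 1 = card ?V"
    by (simp add: card_Diff_singleton)
  also have "\<dots> = (\<Sum>L\<in>lines. card {v \<in> ?V. vec.span {v} = L})"
    using sum.group[of ?V lines "\<lambda>v. vec.span {v}" "\<lambda>_. 1::nat"] by simp
  also have "\<dots> = card (lines :: ('f ^ 'n) set set) * (CARD('f) - 1)"
    using fibre by simp
  finally show ?thesis by simp
qed

lemma point_indicator_eq_sum_lines:
  fixes U :: "('f::{field,finite} ^ 'n) set"
  assumes "vec.subspace U"
  shows "point_indicator U = (\<Sum>L\<in>{L \<in> lines. L \<subseteq> U}. point_indicator L)"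
proof (rule vec_eq_iff[THEN iffD2], rule allI)
  fix v :: "'f ^ 'n"
  show "point_indicator U $ v = (\<Sum>L\<in>{L \<in> lines. L \<subseteq> U}. point_indicator L) $ v"
  proof (cases "v = 0")
    case False
    \<comment> \<open>The only line through \<open>v\<close> is its span, which lies in \<open>U\<close> exactly when \<open>v\<close> does.\<close>
    have "point_indicator L $ v = of_bool (L = vec.span {v})" if "L \<in> {L \<in> lines. L \<subseteq> U}" for L
      using that mem_line_iff[of L v] False by (simp add: point_indicator_def)
    then have "(\<Sum>L\<in>{L \<in> lines. L \<subseteq> U}. point_indicator L) $ v
        = (\<Sum>L\<in>{L \<in> lines. L \<subseteq> U}. of_bool (L = vec.span {v}))"
      by simp
    also have "\<dots> = of_bool (vec.span {v} \<in> {L \<in> lines. L \<subseteq> U})"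
      by (subst sum.cong[OF refl, of _ _ "\<lambda>L. if L = vec.span {v} then 1 else 0"])
        (auto simp: sum.delta)
    also have "\<dots> = of_bool (v \<in> U)"
      using False assms vec.span_minimal[of "{v}" U] vec.span_base[of v "{v}"] by auto
    finally show ?thesis using False by (simp add: point_indicator_def)
  qed (simp add: point_indicator_def)
qed

text \<open>The indicators of lines span a space that contains the indicators of all subspaces.\<close>

lemma dim_point_indicators_le:
  fixes \<U> :: "('f::{field,finite} ^ 'n) set set"
  assumes "\<And>U. U \<in> \<U> \<Longrightarrow> vec.subspace U"
  shows "dim (point_indicator ` \<U>) \<le> card (lines :: ('f ^ 'n) set set)"
proof -
  have "point_indicator ` \<U> \<subseteq> span (point_indicator ` lines)"
  proof (rule image_subsetI)
    fix U assume "U \<in> \<U>"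
    then show "point_indicator U \<in> span (point_indicator ` lines)"
      unfolding point_indicator_eq_sum_lines[OF assms[OF \<open>U \<in> \<U>\<close>]]
      by (intro span_sum span_base) blast
  qed
  then have "dim (point_indicator ` \<U>) \<le> card (point_indicator ` (lines :: ('f ^ 'n) set set))"
    by (rule dim_le_card) simp
  also have "\<dots> \<le> card (lines :: ('f ^ 'n) set set)"
    by (rule card_image_le) simp
  finally show ?thesis .
qed

section \<open>A resolving set from a basis of indicator vectors\<close>

text \<open>Equal distances to \<open>S\<close> make \<open>\<chi>\<^sub>U - \<chi>\<^sub>W\<close> orthogonal to \<open>\<chi>\<^sub>S\<close>.  If this holds for a family \<open>T\<close>
  whose indicators span those of all vertices, \<open>\<chi>\<^sub>U - \<chi>\<^sub>W\<close> is orthogonal to a space that contains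
  it, so it is zero.\<close>

lemma resolving_set_of_spanning_indicators:
  fixes T :: "('f::{field,finite} ^ 'n) set set" and k :: nat
  defines "V \<equiv> pverts (grassmann_graph k)"
  assumes T: "T \<subseteq> V" and spans: "point_indicator ` V \<subseteq> span (point_indicator ` T)"
  shows "resolving_set (with_proj (grassmann_graph k)) T"
proof -
  have "U = W"
    if U: "U \<in> V" and W: "W \<in> V"
      and eq: "\<And>S. S \<in> T \<Longrightarrow> graph_dist (with_proj (grassmann_graph k)) U S
                         = graph_dist (with_proj (grassmann_graph k)) W S" for U W
  proof -
    let ?x = "point_indicator U - point_indicator W"
    have sub: "vec.subspace U" "vec.subspace W"
      using U W by (simp_all add: V_def grassmann_verts)
    have "orthogonal ?x (point_indicator S)" if "S \<in> T" for S
    proof -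
      have S: "S \<in> V" "vec.subspace S" "vec.dim S = k"
        using that T by (auto simp: V_def grassmann_verts)
      have le: "vec.dim (U \<inter> S) \<le> k" "vec.dim (W \<inter> S) \<le> k"
        using vec.dim_subset[of "U \<inter> S" S] vec.dim_subset[of "W \<inter> S" S] S(3) by auto
      have "k - vec.dim (U \<inter> S) = k - vec.dim (W \<inter> S)"
        using eq[OF that] U W S(1) by (simp add: V_def graph_dist_grassmann_eq)
      with le have "card (U \<inter> S) = card (W \<inter> S)"
        using sub S(2) by (intro card_subspace_cong_dim vec.subspace_inter) auto
      then have "card (U \<inter> S - {0}) = card (W \<inter> S - {0})"
        using sub S(2) by (simp add: card_Diff_singleton vec.subspace_0)
      then show ?thesis
        by (simp add: orthogonal_def inner_diff_left inner_point_indicator)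
    qed
    moreover have "?x \<in> span (point_indicator ` T)"
      using spans U W by (intro span_diff) auto
    ultimately have "orthogonal ?x ?x"
      by (intro orthogonal_to_span[of ?x "point_indicator ` T"]) auto
    then show ?thesis
      using point_indicator_inject[OF sub] by (simp add: orthogonal_self)
  qed
  then show ?thesis using T by (auto simp: resolving_set_def V_def)
qed

lemma metric_dimension_grassmann_le_card_lines:
  "metric_dimension (with_proj (grassmann_graph k :: ('f::{field,finite} ^ 'n) set pair_pre_digraph))
     \<le> card (lines :: ('f ^ 'n) set set)"
proof -
  let ?V = "pverts (grassmann_graph k) :: ('f ^ 'n) set set"
  obtain B where B: "B \<subseteq> point_indicator ` ?V" "point_indicator ` ?V \<subseteq> span B"
    "card B = dim (point_indicator ` ?V)"
    by (rule basis_exists[of "point_indicator ` ?V"])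
  obtain T where T: "T \<subseteq> ?V" "inj_on point_indicator T" "B = point_indicator ` T"
    using B(1) subset_image_inj by metis
  have "resolving_set (with_proj (grassmann_graph k)) T"
    using T B(2) by (intro resolving_set_of_spanning_indicators) auto
  then have "metric_dimension (with_proj (grassmann_graph k :: ('f ^ 'n) set pair_pre_digraph)) \<le> card T"
    unfolding metric_dimension_def by (intro Least_le) blast
  also have "card T = dim (point_indicator ` ?V)"
    using T B(3) by (simp add: card_image)
  also have "\<dots> \<le> card (lines :: ('f ^ 'n) set set)"
    by (rule dim_point_indicators_le) (simp add: grassmann_verts)
  finally show ?thesis .
qed

theorem theorem5:
  fixes q n k :: nat
  assumes "q = CARD('f::{field,finite})"
    and "n = CARD('n::finite)"
    and "2 \<le> k" and "real k \<le> real n / 2"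
  shows "real (metric_dimension (with_proj (grassmann_graph k :: ('f ^ 'n) set pair_pre_digraph)))
           \<le> gaussian_binomial q n 1
         \<and> gaussian_binomial q n 1 = (real q ^ n - 1) / (real q - 1)"
proof -
  have "card {0, 1 :: 'f} \<le> q"
    unfolding assms(1) by (rule card_mono) auto
  then have q: "2 \<le> q" by simp
  have gb: "gaussian_binomial q n 1 = (real q ^ n - 1) / (real q - 1)"
    by (simp add: gaussian_binomial_def)
  let ?l = "card (lines :: ('f ^ 'n) set set)"
  have "?l * (q - 1) = q ^ n - 1"
    using card_lines[where 'f='f and 'n='n] assms(1,2) by simp
  then have "real (?l * (q - 1)) = real (q ^ n - 1)" by simp
  then have "real ?l * (real q - 1) = real q ^ n - 1"
    using q by (simp add: of_nat_diff)
  then have "real ?l = (real q ^ n - 1) / (real q - 1)"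
    using q by (simp add: field_simps)
  with gb metric_dimension_grassmann_le_card_lines[of k, where 'f='f and 'n='n] show ?thesis
    by simp
qed

end
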